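(* Let $ABC$ be a triangle with circumcircle $\Omega$, let $P$ be a point with isogonal conjugate $P'$ with respect to $ABC$, and let $D$ be the intersection of $\Omega$ with the conic $(ABCPP')$ other than $A,B,C$. Let $X$ be the second intersection of line $DP$ with $\Omega$ and $Y$ the second intersection of line $DP'$ with $\Omega$. Let the circle $(PXY)$ meet line $PP'$ again at $Z$. (a) The circle $(PXY)$ and the conic $(ABCPZ)$ are tangent at $P$ and at $Z$. (b) Let the circle $(PXY)$ meet the conic $(ABCPX)$ at the points $Z_1, Z_2$ (other than $P, X$). Let lines $XZ_1, XZ_2$ meet $\Omega$ again at $Z_1', Z_2'$ respectively. Then line $Z_1'Z_2'$ is tangent to the conic $(ABCPP')$ at $P'$.
   Context: For points $X,Y,Z$, $(XYZ)$ denotes the circle through them; for five points $V,W,X,Y,Z$, $(VWXYZ)$ denotes the conic through them. *)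

theory Defs
  imports "HOL-Analysis.Analysis"
begin

text \<open>Points of the real plane are complex numbers.  A conic (or circle) is given by the
coefficients (a,b,c,d,e,f) of  a x^2 + b x y + c y^2 + d x + e y + f = 0.\<close>

type_synonym conic = "real \<times> real \<times> real \<times> real \<times> real \<times> real"

definition on_conic :: "conic \<Rightarrow> complex \<Rightarrow> bool" where
  "on_conic K z = (case K of (a,b,c,d,e,f) \<Rightarrow>
     a * (Re z)^2 + b * Re z * Im z + c * (Im z)^2 + d * Re z + e * Im z + f = 0)"

definition is_conic :: "conic \<Rightarrow> bool" where
  "is_conic K = (case K of (a,b,c,d,e,f) \<Rightarrow> (a,b,c) \<noteq> (0,0,0))"

definition is_circle :: "conic \<Rightarrow> bool" where
  "is_circle K = (case K of (a,b,c,d,e,f) \<Rightarrow> a \<noteq> 0 \<and> a = c \<and> b = 0 \<and> d^2 + e^2 > 4*a*f)"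

definition conic_scale :: "real \<Rightarrow> conic \<Rightarrow> conic" where
  "conic_scale t K = (case K of (a,b,c,d,e,f) \<Rightarrow> (t*a,t*b,t*c,t*d,t*e,t*f))"

definition conic_grad :: "conic \<Rightarrow> complex \<Rightarrow> complex" where
  "conic_grad K z = (case K of (a,b,c,d,e,f) \<Rightarrow>
     Complex (2*a*Re z + b*Im z + d) (b*Re z + 2*c*Im z + e))"

definition unique_conic5 :: "complex \<Rightarrow> complex \<Rightarrow> complex \<Rightarrow> complex \<Rightarrow> complex \<Rightarrow> bool" where
  "unique_conic5 p1 p2 p3 p4 p5 =
     ((\<exists>K. is_conic K \<and> (\<forall>p\<in>{p1,p2,p3,p4,p5}. on_conic K p)) \<and>
      (\<forall>K1 K2. is_conic K1 \<and> is_conic K2 \<and> (\<forall>p\<in>{p1,p2,p3,p4,p5}. on_conic K1 p) \<and>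
               (\<forall>p\<in>{p1,p2,p3,p4,p5}. on_conic K2 p) \<longrightarrow> (\<exists>t. t \<noteq> 0 \<and> K2 = conic_scale t K1)))"

text \<open>Two curves are tangent at p: both pass through p and their gradients at p are
  linearly dependent (intersection multiplicity at least 2).\<close>
definition curves_tangent_at :: "conic \<Rightarrow> conic \<Rightarrow> complex \<Rightarrow> bool" where
  "curves_tangent_at K1 K2 p = (on_conic K1 p \<and> on_conic K2 p \<and>
      Im (cnj (conic_grad K1 p) * conic_grad K2 p) = 0)"

definition line_tangent_at :: "complex \<Rightarrow> complex \<Rightarrow> conic \<Rightarrow> complex \<Rightarrow> bool" where
  "line_tangent_at u v K p = (u \<noteq> v \<and> collinear {u, v, p} \<and> on_conic K p \<and>
      Re (cnj (conic_grad K p) * (v - u)) = 0)"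

definition reflect_line :: "complex \<Rightarrow> complex \<Rightarrow> complex \<Rightarrow> complex" where
  "reflect_line Q w z = Q + (w / cnj w) * cnj (z - Q)"

definition bisector_dir :: "complex \<Rightarrow> complex \<Rightarrow> complex \<Rightarrow> complex" where
  "bisector_dir V U W = (U - V) / of_real (cmod (U - V)) + (W - V) / of_real (cmod (W - V))"

definition isogonal_conj :: "complex \<Rightarrow> complex \<Rightarrow> complex \<Rightarrow> complex \<Rightarrow> complex \<Rightarrow> bool" where
  "isogonal_conj A B C P P' =
     (collinear {A, reflect_line A (bisector_dir A B C) P, P'} \<and>
      collinear {B, reflect_line B (bisector_dir B C A) P, P'} \<and>
      collinear {C, reflect_line C (bisector_dir C A B) P, P'})"

end

theory Submission
  imports Defs
begin

text \<open>Take \<open>\<Omega>\<close> to be the unit circle and \<open>D = 1\<close>, and let \<open>s1, s2, s3\<close> be the elementary symmetric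
functions of the vertices. Writing \<open>z~\<close> for the conjugate of \<open>z\<close>, the points \<open>p\<close> and \<open>q\<close> are
isogonal conjugates iff \<open>p + q + s3 p~ q~ = s1\<close>, and a conic through the vertices has an equation
\<open>\<beta> (|z|^2 - 1) + 2 Re (\<alpha> G(z)) = 0\<close> with \<open>G(z) = z^2 - s1 z + s2 - s3 z~\<close>. Its fourth
intersection with the unit circle is \<open>\<alpha>~ / (\<alpha> s3)\<close>. Since \<open>G(p) = s3 q~ (1 - |p|^2)\<close>, it passes
through \<open>p\<close> iff \<open>\<beta> = 2 Re (\<alpha> s3 q~)\<close>; hence \<open>D = 1\<close> means \<open>s3 w~ = - w\<close> for \<open>w = p - q\<close>, and
everything is a rational function of \<open>u = 1 - p\<close>, \<open>v = 1 - q\<close> and their conjugates.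

For (a), if \<open>L = 0\<close> is the line \<open>PP'\<close>, a suitable combination \<open>s \<Gamma> + L^2\<close> vanishes at the vertices;
it has double contact with \<open>\<Gamma>\<close> at \<open>P\<close> and \<open>Z\<close>, so by uniqueness it is the conic \<open>(ABCPZ)\<close>. For (b),
projecting \<open>\<Gamma>\<close> from \<open>X\<close> to \<open>\<Omega>\<close> is a similarity fixing \<open>Y\<close>, which turns the conic \<open>(ABCPX)\<close> into a
quartic on the unit circle with two known roots; the other two, \<open>Z1'\<close> and \<open>Z2'\<close>, have their sum and
product given by Vieta.\<close>

section \<open>Collinearity and chords of the unit circle\<close>

lemma collinear_complex_iff:
  fixes u v w :: complex
  shows "collinear {u, v, w} \<longleftrightarrow> (v - u) * cnj (w - u) = cnj (v - u) * (w - u)"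
proof -
  have "collinear {u, v, w} \<longleftrightarrow> collinear {0, v - u, w - u}"
    using collinear_3[of v u w] by (simp only: NO_MATCH_def insert_commute[of u v] simp_thms)
  also have "\<dots> \<longleftrightarrow> (w - u) / (v - u) \<in> \<real>" by (rule collinear_iff_Reals)
  also have "\<dots> \<longleftrightarrow> (v - u) * cnj (w - u) = cnj (v - u) * (w - u)"
    by (cases "v = u") (auto simp: Reals_cnj_iff field_simps)
  finally show ?thesis .
qed

text \<open>Conjugation is inversion on the unit circle, so the collinearity condition acquires the
  factor \<open>x - d\<close>; the cofactor is the chord equation, linear in \<open>p\<close> and
  its conjugate.\<close>

lemma unit_chord:
  fixes d x p :: complex
  assumes "d * cnj d = 1" "x * cnj x = 1" "x \<noteq> d" "collinear {d, p, x}"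
  shows "p + d * x * cnj p = d + x"
proof -
  have "(p - d) * cnj (x - d) = cnj (p - d) * (x - d)"
    using assms(4) by (simp only: collinear_complex_iff)
  hence "(x - d) * (p + d * x * cnj p - d - x) = 0"
    using assms(1,2) unfolding complex_cnj_diff by algebra
  hence "p + d * x * cnj p - d - x = 0" using assms(3) by simp
  thus ?thesis by algebra
qed

lemma collinear_chord:
  fixes z1 z2 q :: complex
  assumes "z1 * cnj z1 = 1" "z2 * cnj z2 = 1" "q + z1 * z2 * cnj q = z1 + z2"
  shows "collinear {z1, z2, q}"
proof -
  have "z1 * z2 \<noteq> 0" using assms(1,2) by auto
  moreover have "z1 * z2 * ((z2 - z1) * (cnj q - cnj z1) - (cnj z2 - cnj z1) * (q - z1)) = 0"
    using assms by algebra
  ultimately show ?thesis by (simp add: collinear_complex_iff)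
qed

section \<open>Conics as real-valued forms in \<open>z\<close> and its conjugate, and root
  counting\<close>

definition hform :: "complex \<Rightarrow> real \<Rightarrow> complex \<Rightarrow> real \<Rightarrow> complex \<Rightarrow> complex" where
  "hform \<alpha> \<beta> \<gamma> \<delta> z = \<alpha> * z^2 + cnj \<alpha> * (cnj z)^2 + of_real \<beta> * z * cnj z
     + \<gamma> * z + cnj \<gamma> * cnj z + of_real \<delta>"

lemma quadratic_three_roots:
  fixes n0 n1 n2 :: "'a::idom"
  assumes "n2 * a^2 + n1 * a + n0 = 0" "n2 * b^2 + n1 * b + n0 = 0" "n2 * c^2 + n1 * c + n0 = 0"
    and "a \<noteq> b" "b \<noteq> c" "c \<noteq> a"
  shows "n2 = 0" "n1 = 0" "n0 = 0"
proof -
  have "(a - b) * (n2 * (a + b) + n1) = 0" "(b - c) * (n2 * (b + c) + n1) = 0"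
    using assms(1-3) by algebra+
  hence *: "n2 * (a + b) + n1 = 0" "n2 * (b + c) + n1 = 0" using assms(4,5) by auto
  have "n2 * (a - c) = 0" using * by algebra
  thus "n2 = 0" using assms(6) by auto
  thus "n1 = 0" using * by simp
  thus "n0 = 0" using \<open>n2 = 0\<close> assms(1) by simp
qed

text \<open>Subtracting \<open>c4 * (z - r1) * (z - r2) * (z - r3) * (z - r4)\<close> leaves a cubic
  with four distinct roots, which must be zero.\<close>

lemma quartic_vieta:
  fixes c0 c1 c2 c3 c4 :: "'a::idom"
  assumes roots: "\<And>z. z \<in> {r1, r2, r3, r4} \<Longrightarrow> c4 * z^4 + c3 * z^3 + c2 * z^2 + c1 * z + c0 = 0"
    and "distinct [r1, r2, r3, r4]"
  shows "c3 = - c4 * (r1 + r2 + r3 + r4)" "c0 = c4 * (r1 * r2 * r3 * r4)"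
proof -
  define n3 where "n3 = c3 + c4 * (r1 + r2 + r3 + r4)"
  define n2 where "n2 = c2 - c4 * (r1*r2 + r1*r3 + r1*r4 + r2*r3 + r2*r4 + r3*r4)"
  define n1 where "n1 = c1 + c4 * (r1*r2*r3 + r1*r2*r4 + r1*r3*r4 + r2*r3*r4)"
  define n0 where "n0 = c0 - c4 * (r1 * r2 * r3 * r4)"
  have cub: "n3 * z^3 + n2 * z^2 + n1 * z + n0 = 0" if "z \<in> {r1, r2, r3, r4}" for z
  proof -
    have "(z - r1) * (z - r2) * (z - r3) * (z - r4) = 0" using that by auto
    thus ?thesis using roots[OF that] unfolding n0_def n1_def n2_def n3_def by algebra
  qed
  have quad: "n3 * z^2 + (n2 + n3 * r4) * z + (n1 + n2 * r4 + n3 * r4^2) = 0"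
    if "z \<in> {r1, r2, r3}" for z
  proof -
    have "(z - r4) * (n3 * z^2 + (n2 + n3 * r4) * z + (n1 + n2 * r4 + n3 * r4^2)) = 0"
    proof -
      have "n3 * z^3 + n2 * z^2 + n1 * z + n0 = 0" "n3 * r4^3 + n2 * r4^2 + n1 * r4 + n0 = 0"
        using that by (auto intro!: cub)
      thus ?thesis by algebra
    qed
    thus ?thesis using that assms(2) by auto
  qed
  have "n3 = 0" "n2 + n3 * r4 = 0" "n1 + n2 * r4 + n3 * r4^2 = 0"
    using quadratic_three_roots[OF quad[of r1] quad[of r2] quad[of r3]] assms(2) by auto
  hence "n3 = 0" "n0 = 0" using cub[of r4] by auto
  thus "c3 = - c4 * (r1 + r2 + r3 + r4)" "c0 = c4 * (r1 * r2 * r3 * r4)"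
    unfolding n3_def n0_def by algebra+
qed

section \<open>Isogonal points and circumscribed conics when the circumcircle is the unit
  circle\<close>

locale unit_isogonal =
  fixes a b c p q :: complex
  assumes unit: "a * cnj a = 1" "b * cnj b = 1" "c * cnj c = 1"
    and dist: "a \<noteq> b" "b \<noteq> c" "c \<noteq> a"
    and isog: "p + q + a * b * c * cnj p * cnj q = a + b + c"
    and P_off: "p * cnj p \<noteq> 1"
begin

definition "s1 = a + b + c"
definition "s2 = a * b + b * c + c * a"
definition "s3 = a * b * c"

lemma s3_unit: "s3 * cnj s3 = 1"
  unfolding s3_def complex_cnj_mult using unit by algebra

lemma s2_cnj: "s2 = s3 * cnj s1" "cnj s2 = cnj s3 * s1"
  unfolding s1_def s2_def s3_def complex_cnj_add complex_cnj_mult using unit by algebra+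

lemma s1_eq: "s1 = p + q + s3 * cnj p * cnj q"
  using isog by (simp add: s1_def s3_def)

lemma s2_eq: "s2 = s3 * (cnj p + cnj q) + p * q"
proof -
  have "cnj s1 = cnj p + cnj q + cnj s3 * p * q" by (subst s1_eq) simp
  thus ?thesis using s2_cnj(1) s3_unit by algebra
qed

lemma cubic: "(t - a) * (t - b) * (t - c) = t^3 - s1 * t^2 + s2 * t - s3"
  unfolding s1_def s2_def s3_def by algebra

text \<open>On the unit circle, \<open>t^2\<close> times the form is
  \<open>\<alpha> * t - cnj \<alpha> * cnj s3\<close> times the cubic of the vertices, plus
  \<open>t * (n2 * t^2 + n1 * t + n0)\<close>. The quadratic vanishes at three points, hence
  identically.\<close>

lemma hform_circumscribed:
  assumes "hform \<alpha> \<beta> \<gamma> \<delta> a = 0" "hform \<alpha> \<beta> \<gamma> \<delta> b = 0" "hform \<alpha> \<beta> \<gamma> \<delta> c = 0"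
  shows "\<gamma> = - cnj \<alpha> * cnj s3 - \<alpha> * s1"
    and "of_real \<beta> + of_real \<delta> = \<alpha> * s2 + cnj \<alpha> * cnj s2"
proof -
  define n2 where "n2 = \<gamma> + cnj \<alpha> * cnj s3 + \<alpha> * s1"
  define n1 where "n1 = of_real \<beta> + of_real \<delta> - \<alpha> * s2 - cnj \<alpha> * cnj s2"
  define n0 where "n0 = cnj \<gamma> + \<alpha> * s3 + cnj \<alpha> * cnj s1"
  have "n2 * t^2 + n1 * t + n0 = 0"
    if "hform \<alpha> \<beta> \<gamma> \<delta> t = 0" "t * cnj t = 1" "(t - a) * (t - b) * (t - c) = 0" for t
  proof -
    have "t \<noteq> 0" using that(2) by auto
    have "t^3 - s1 * t^2 + s2 * t - s3 = 0" using that(3) cubic by simp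
    hence "t * (n2 * t^2 + n1 * t + n0) = 0"
      using that(1,2) s3_unit s2_cnj unfolding hform_def n2_def n1_def n0_def by algebra
    thus ?thesis using \<open>t \<noteq> 0\<close> by simp
  qed
  hence "n2 * a^2 + n1 * a + n0 = 0" "n2 * b^2 + n1 * b + n0 = 0" "n2 * c^2 + n1 * c + n0 = 0"
    using assms unit by simp_all
  from quadratic_three_roots[OF this dist] have "n2 = 0" "n1 = 0" by auto
  thus "\<gamma> = - cnj \<alpha> * cnj s3 - \<alpha> * s1" "of_real \<beta> + of_real \<delta> = \<alpha> * s2 + cnj \<alpha> * cnj s2"
    unfolding n2_def n1_def by algebra+
qed

text \<open>With zero remainder in the division by the cubic, the linear quotient
  \<open>\<alpha> * t - cnj \<alpha> * cnj s3\<close> must vanish at the fourth point.\<close>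

lemma fourth_intersection:
  assumes "hform \<alpha> \<beta> \<gamma> \<delta> a = 0" "hform \<alpha> \<beta> \<gamma> \<delta> b = 0" "hform \<alpha> \<beta> \<gamma> \<delta> c = 0"
    and "hform \<alpha> \<beta> \<gamma> \<delta> d = 0" "d * cnj d = 1" "d \<noteq> a" "d \<noteq> b" "d \<noteq> c"
  shows "cnj \<alpha> = d * s3 * \<alpha>"
proof -
  note g = hform_circumscribed[OF assms(1-3)]
  have g': "cnj \<gamma> = - \<alpha> * s3 - cnj \<alpha> * cnj s1" by (subst g(1)) simp
  have "(d - a) * (d - b) * (d - c) * (\<alpha> * d - cnj \<alpha> * cnj s3) = 0"
    using g g' assms(4,5) s3_unit s2_cnj unfolding cubic hform_def by algebra
  hence "\<alpha> * d - cnj \<alpha> * cnj s3 = 0" using assms(6-8) by simp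
  thus ?thesis using s3_unit by algebra
qed

text \<open>For \<open>p\<close> off the circle this turns incidence with \<open>p\<close> into a
  real-linear condition on the isogonal point \<open>q\<close>.\<close>

lemma hform_isogonal:
  assumes "hform \<alpha> \<beta> \<gamma> \<delta> a = 0" "hform \<alpha> \<beta> \<gamma> \<delta> b = 0" "hform \<alpha> \<beta> \<gamma> \<delta> c = 0"
  shows "hform \<alpha> \<beta> \<gamma> \<delta> p = (p * cnj p - 1) * (of_real \<beta> - \<alpha> * s3 * cnj q - cnj \<alpha> * cnj s3 * q)"
proof -
  note g = hform_circumscribed[OF assms(1-3)]
  have g': "cnj \<gamma> = - \<alpha> * s3 - cnj \<alpha> * cnj s1" by (subst g(1)) simp
  have "cnj s1 = cnj p + cnj q + cnj s3 * p * q"  by (subst s1_eq) simp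
  moreover have "cnj s2 = cnj s3 * (p + q) + cnj p * cnj q"  by (subst s2_eq) simp
  ultimately show ?thesis
    using g g' s1_eq s2_eq s3_unit unfolding hform_def by algebra
qed

lemma swap: "unit_isogonal a b c q p" if "q * cnj q \<noteq> 1"
  using unit dist isog that by unfold_locales (simp_all add: algebra_simps)

text \<open>If \<open>q\<close> were on the circle, the formulas for \<open>s1\<close> and
  \<open>s2\<close> would make it a root of the cubic, hence a vertex, and the isogonal relation
  would put \<open>p\<close> on the opposite side.\<close>

lemma Q_off_circle:
  assumes "\<not> collinear {a, b, p}" "\<not> collinear {b, c, p}" "\<not> collinear {c, a, p}"
  shows "q * cnj q \<noteq> 1"
proof
  assume q: "q * cnj q = 1"
  have "(q - a) * (q - b) * (q - c) = 0"
    using q s1_eq s2_eq unfolding cubic by algebra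
  hence "q = a \<or> q = b \<or> q = c" by simp
  moreover have "p + b * c * cnj p = b + c" if "q = a" using isog unit that by algebra
  moreover have "p + c * a * cnj p = c + a" if "q = b" using isog unit that by algebra
  moreover have "p + a * b * cnj p = a + b" if "q = c" using isog unit that by algebra
  ultimately show False using assms collinear_chord unit by blast
qed

text \<open>The hypothesis on \<open>\<alpha>\<close> is what \<open>fourth_intersection\<close>
  gives for \<open>d = 1\<close>. Incidence with \<open>p\<close> and with \<open>q\<close> yields
  two expressions for \<open>\<beta>\<close>; equating them and cancelling \<open>\<alpha>\<close>
  gives the relation.\<close>

lemma fourth_intersection_direction:
  assumes K: "hform \<alpha> \<beta> \<gamma> \<delta> a = 0" "hform \<alpha> \<beta> \<gamma> \<delta> b = 0" "hform \<alpha> \<beta> \<gamma> \<delta> c = 0"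
      "hform \<alpha> \<beta> \<gamma> \<delta> p = 0" "hform \<alpha> \<beta> \<gamma> \<delta> q = 0" "\<alpha> \<noteq> 0 \<or> \<beta> \<noteq> 0"
    and q: "q * cnj q \<noteq> 1" and \<alpha>: "cnj \<alpha> = s3 * \<alpha>"
  shows "s3 * (cnj p - cnj q) = - (p - q)"
proof -
  interpret qp: unit_isogonal a b c q p using q by (rule swap)
  have "of_real \<beta> - \<alpha> * s3 * cnj q - cnj \<alpha> * cnj s3 * q = 0"
    using hform_isogonal[OF K(1-3)] K(4) P_off by simp
  moreover have "of_real \<beta> - \<alpha> * s3 * cnj p - cnj \<alpha> * cnj s3 * p = 0"
    using qp.hform_isogonal[OF K(1-3)] K(5) q by simp
  ultimately have "\<alpha> * (s3 * (cnj p - cnj q) + (p - q)) = 0"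
    and "of_real \<beta> = \<alpha> * (s3 * cnj p + p)" using \<alpha> s3_unit by algebra+
  moreover from this have "\<alpha> \<noteq> 0" using K(6) by auto
  ultimately have "s3 * (cnj p - cnj q) + (p - q) = 0" by simp
  thus ?thesis by algebra
qed

end

section \<open>The configuration normalised to \<open>D = 1\<close>\<close>

locale normalized_configuration = unit_isogonal +
  fixes x y :: complex
  assumes pq: "p \<noteq> q"
    and Q_off: "q * cnj q \<noteq> 1"
    and s3_pq: "s3 * (cnj p - cnj q) = - (p - q)"
    and x_unit: "x * cnj x = 1" and y_unit: "y * cnj y = 1"
    and x_chord: "p + x * cnj p = 1 + x" and y_chord: "q + y * cnj q = 1 + y"
    and y1: "y \<noteq> 1" and xy: "x \<noteq> y"
begin

definition "u = 1 - p"
definition "v = 1 - q"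
definition "w = p - q"
definition "\<sigma> = v + cnj v"
text \<open>\<open>\<sigma> * Z = \<kappa> * z - u * v\<close> is the similarity from the unit
  circle to \<open>(PXY)\<close> given by projection from \<open>x\<close>; it sends
  \<open>1\<close> to \<open>p\<close> and fixes \<open>y\<close>.\<close>

definition "\<kappa> = \<sigma> - u * cnj v"

lemmas uvw_defs = u_def v_def w_def complex_cnj_diff complex_cnj_one

lemma cnj_\<sigma>: "cnj \<sigma> = \<sigma>"
  by (simp add: \<sigma>_def)

lemma cnj_\<kappa>: "cnj \<kappa> = \<sigma> - cnj u * v"
  by (simp add: \<kappa>_def cnj_\<sigma>)

lemma nz: "u \<noteq> 0" "v \<noteq> 0" "w \<noteq> 0"
  using P_off Q_off pq by (auto simp: u_def v_def w_def)

lemma xu: "cnj u * x = - u" and yv: "cnj v * y = - v"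
  using x_chord y_chord unfolding uvw_defs by algebra+

lemma s3_w: "s3 * cnj w = - w"
  using s3_pq by (simp add: uvw_defs)

lemma \<sigma>_nz: "\<sigma> \<noteq> 0"
proof
  assume "\<sigma> = 0"
  hence "cnj v * (y - 1) = 0" using yv unfolding \<sigma>_def by algebra
  thus False using nz y1 by simp
qed

lemma \<kappa>_nz: "\<kappa> \<noteq> 0"
proof
  assume "\<kappa> = 0"
  hence "cnj v * (p - y) = 0" using yv unfolding \<kappa>_def \<sigma>_def u_def by algebra
  hence "p = y" using nz by simp
  thus False using P_off y_unit by simp
qed

text \<open>If \<open>x\<close> were a vertex \<open>t\<close>, the conic through \<open>p\<close> and \<open>q\<close> would contain the line through
  \<open>1\<close>, \<open>p\<close>, \<open>t\<close>, and then \<open>y = t\<close> as well.\<close>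
lemma x_not_vertex:
  assumes t: "t * cnj t = 1" "(t - a) * (t - b) * (t - c) = 0"
  shows "x \<noteq> t"
proof
  assume "x = t"
  have "t^3 - s1 * t^2 + s2 * t - s3 = 0" using t(2) cubic by simp
  \<comment> \<open>Multiplying the cubic by \<open>cnj w\<close> eliminates \<open>s3\<close>,
    since \<open>s3 * cnj w = - w\<close>.\<close>
  hence "(t - p) * (t - q) * t * cnj w + w * (t * cnj p - 1) * (t * cnj q - 1) = 0"
    using s1_eq s2_eq s3_w by algebra
  moreover have "p + t * cnj p = 1 + t" using x_chord \<open>x = t\<close> by simp
  ultimately have "(t - p) * (t - p) * (1 + t - q - t * cnj q) = 0"
    unfolding uvw_defs by algebra
  moreover have "t \<noteq> p" using t P_off by auto
  ultimately have "1 + t - q - t * cnj q = 0" by simp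
  hence "cnj v * (t - y) = 0" using y_chord unfolding uvw_defs by algebra
  thus False using nz xy \<open>x = t\<close> by simp
qed

text \<open>Removing \<open>g * (z * cnj z - 1)\<close> from the form leaves the radical axis with
  the unit circle, the line \<open>xy\<close>. This ties \<open>cnj \<gamma>\<close> to
  \<open>\<gamma>\<close>, and incidence with \<open>p\<close> then determines
  \<open>\<gamma>\<close>.\<close>

lemma circle_PXY:
  assumes "hform 0 g \<gamma> \<delta> x = 0" "hform 0 g \<gamma> \<delta> y = 0" "hform 0 g \<gamma> \<delta> p = 0"
  shows "\<sigma> * hform 0 g \<gamma> \<delta> z = of_real g * (\<sigma> * (z * cnj z - 1) + cnj u * cnj v * z
     + u * v * cnj z + u * cnj v + cnj u * v)"
proof -
  have e: "of_real g + of_real \<delta> + \<gamma> * x + cnj \<gamma> * cnj x = 0"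
    "of_real g + of_real \<delta> + \<gamma> * y + cnj \<gamma> * cnj y = 0"
    using assms(1,2) x_unit y_unit unfolding hform_def complex_cnj_zero by algebra+
  hence "(x - y) * (\<gamma> * x * y - cnj \<gamma>) = 0" using x_unit y_unit by algebra
  hence c: "cnj \<gamma> = \<gamma> * x * y" using xy by simp
  have d: "of_real g + of_real \<delta> = - \<gamma> * (x + y)" using e(1) c x_unit by algebra
  have "of_real g * (p * cnj p - 1) + \<gamma> * (p + x * y * cnj p - x - y) = 0"
    using assms(3) c d unfolding hform_def complex_cnj_zero by algebra
  hence "(p * cnj p - 1) * (of_real g * cnj u * cnj v - \<gamma> * \<sigma>) = 0"
    using xu yv unfolding \<sigma>_def uvw_defs by algebra
  hence g: "\<gamma> * \<sigma> = of_real g * cnj u * cnj v" using P_off by simp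
  have g': "cnj \<gamma> * \<sigma> = of_real g * u * v" using c g xu yv by algebra
  have "\<sigma> * (of_real g + of_real \<delta>) = of_real g * (u * cnj v + cnj u * v)"
    using d g xu yv by algebra
  thus ?thesis using g g' unfolding hform_def complex_cnj_zero by algebra
qed

text \<open>The squared bracket vanishes exactly on the line \<open>pq\<close>, so at every vertex
  the circle equation is the same multiple of the squared line equation.\<close>

lemma double_contact:
  assumes "hform 0 g \<gamma> \<delta> x = 0" "hform 0 g \<gamma> \<delta> y = 0" "hform 0 g \<gamma> \<delta> p = 0"
    and t: "t * cnj t = 1" "(t - a) * (t - b) * (t - c) = 0"
  shows "\<sigma> * w * cnj w * hform 0 g \<gamma> \<delta> t = - of_real g * (cnj w * (t - p) - w * (cnj t - cnj p))^2"
proof -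
  \<comment> \<open>\<open>E + F = u + t * cnj u\<close> and \<open>E' + F' = v + t * cnj v\<close>,
    so \<open>(E + F) * (E' + F')\<close> is \<open>t\<close> times the part of
    \<open>circle_PXY\<close> without \<open>\<sigma>\<close>; and \<open>F' * E - E' * F\<close> is
    \<open>t\<close> times the line equation.\<close>
  define E E' F F' where EF: "E = t - p" "E' = t - q" "F = 1 - t * cnj p" "F' = 1 - t * cnj q"
  have "t^3 - s1 * t^2 + s2 * t - s3 = 0" using t(2) cubic by simp
  hence "E * E' * t * cnj w + w * F * F' = 0"
    using s1_eq s2_eq s3_w unfolding EF by algebra
  moreover have tw: "t * cnj w = F' - F" and w: "w = E' - E" unfolding EF uvw_defs by algebra+
  ultimately have *: "E' * F' * (E + F) = E * F * (E' + F')" by algebra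
  have "t^2 * (w * cnj w * (cnj u * cnj v * t + u * v * cnj t + u * cnj v + cnj u * v))
      = w * (t * cnj w) * ((E + F) * (E' + F'))"
    using t(1) unfolding EF uvw_defs by algebra
  also have "\<dots> = - ((F' * E - E' * F)^2)" using * tw w by algebra
  also have "\<dots> = - (((F' - F) * E - (E' - E) * F)^2)" by algebra
  also have "\<dots> = t^2 * (- ((cnj w * (t - p) - w * (cnj t - cnj p))^2))"
    using t(1) unfolding EF uvw_defs by algebra
  finally have "w * cnj w * (cnj u * cnj v * t + u * v * cnj t + u * cnj v + cnj u * v)
      = - ((cnj w * (t - p) - w * (cnj t - cnj p))^2)"
    using t(1) by (simp only: mult_cancel_left) auto
  thus ?thesis using circle_PXY[OF assms(1-3), of t] t(1) by algebra
qed

text \<open>The chord equation eliminates \<open>cnj Z\<close> from the circle equation; the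
  resulting quadratic has the known root \<open>x\<close>, and its cofactor is linear in
  \<open>Z\<close>.\<close>

lemma second_point_on_circle_PXY:
  assumes "hform 0 g \<gamma> \<delta> x = 0" "hform 0 g \<gamma> \<delta> y = 0" "hform 0 g \<gamma> \<delta> p = 0" "g \<noteq> 0"
    and Z: "hform 0 g \<gamma> \<delta> Z = 0" "Z \<noteq> x" and z: "z * cnj z = 1" "z \<noteq> x" "collinear {x, Z, z}"
  shows "\<sigma> * Z = \<kappa> * z - u * v"
proof -
  have ch: "Z + x * z * cnj Z = x + z"
    using unit_chord[OF x_unit z(1) z(2) z(3)] .
  have "\<sigma> * (Z * cnj Z - 1) + cnj u * cnj v * Z + u * v * cnj Z + u * cnj v + cnj u * v = 0"
    using circle_PXY[OF assms(1-3), of Z] Z(1) assms(4) by auto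
  hence "(Z - x) * (\<sigma> * Z - \<kappa> * z + u * v) = 0"
    using ch xu unfolding \<kappa>_def by algebra
  hence "\<sigma> * Z - \<kappa> * z + u * v = 0" using Z(2) by simp
  thus ?thesis by algebra
qed

text \<open>The known roots of the quartic are \<open>1\<close> (for \<open>Z = p\<close>) and \<open>r\<close> (for \<open>Z = x\<close>).\<close>

lemma chord_from_quartic:
  assumes K: "hform \<alpha> \<beta> \<gamma> \<delta> a = 0" "hform \<alpha> \<beta> \<gamma> \<delta> b = 0" "hform \<alpha> \<beta> \<gamma> \<delta> c = 0"
      "hform \<alpha> \<beta> \<gamma> \<delta> p = 0" "hform \<alpha> \<beta> \<gamma> \<delta> x = 0" "\<alpha> \<noteq> 0 \<or> \<beta> \<noteq> 0"
    and Z: "hform \<alpha> \<beta> \<gamma> \<delta> Z1 = 0" "hform \<alpha> \<beta> \<gamma> \<delta> Z2 = 0"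
      "Z1 \<noteq> p" "Z1 \<noteq> x" "Z2 \<noteq> p" "Z2 \<noteq> x"
    and z: "z1 * cnj z1 = 1" "z2 * cnj z2 = 1" "z1 \<noteq> z2"
      "\<sigma> * Z1 = \<kappa> * z1 - u * v" "\<sigma> * Z2 = \<kappa> * z2 - u * v"
  shows "\<kappa> * z1 * z2 = s3 * cnj \<kappa>" "q + z1 * z2 * cnj q = z1 + z2"
proof -
  have "x \<noteq> a" "x \<noteq> b" "x \<noteq> c" using x_not_vertex unit by auto
  hence \<alpha>: "cnj \<alpha> = x * s3 * \<alpha>" using fourth_intersection[OF K(1-3,5) x_unit] by simp
  have "of_real \<beta> - \<alpha> * s3 * cnj q - cnj \<alpha> * cnj s3 * q = 0"
    using hform_isogonal[OF K(1-3)] K(4) P_off by simp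
  hence \<beta>: "of_real \<beta> = \<alpha> * (s3 * cnj q + x * q)" using \<alpha> s3_unit by algebra
  have \<alpha>nz: "\<alpha> \<noteq> 0" using \<beta> K(6) by auto
  have \<gamma>: "\<gamma> = - \<alpha> * (x + s1)" using hform_circumscribed(1)[OF K(1-3)] \<alpha> s3_unit by algebra
  \<comment> \<open>The preimage of \<open>x\<close> under the similarity, obtained by solving
    \<open>\<sigma> * x = \<kappa> * r - u * v\<close>.\<close>
  define r where "r = - (u * cnj \<kappa>) / (cnj u * \<kappa>)"
  have r: "r * cnj u * \<kappa> = - u * cnj \<kappa>" using nz \<kappa>_nz by (simp add: r_def)
  have r_unit: "r * cnj r = 1" using nz \<kappa>_nz by (simp add: r_def)
  have "cnj u * (\<sigma> * x) = cnj u * (\<kappa> * r - u * v)" using r xu cnj_\<kappa> by algebra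
  hence zx: "\<sigma> * x = \<kappa> * r - u * v" using nz by simp
  have zp: "\<sigma> * p = \<kappa> * 1 - u * v" unfolding \<kappa>_def \<sigma>_def uvw_defs by algebra
  have "x \<noteq> p" using x_unit P_off by auto
  \<comment> \<open>Used by contraposition: points known to differ have different parameters on the
    unit circle.\<close>
  have proj: "S = T" if "\<sigma> * S = \<kappa> * s - u * v" "\<sigma> * T = \<kappa> * t - u * v" "s = t" for S T s t
    using that \<sigma>_nz by (metis mult_left_cancel)
  have dist4: "distinct [1, r, z1, z2]"
    using z(3) Z(3-6) \<open>x \<noteq> p\<close> proj[OF zp zx] proj[OF zp z(4)] proj[OF zp z(5)]
      proj[OF zx z(4)] proj[OF zx z(5)] by auto
  \<comment> \<open>Coefficients of \<open>\<sigma>^2 * s^2\<close> times the form at the image of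
    \<open>s\<close>. The form is real-valued and \<open>cnj s\<close> is the inverse of
    \<open>s\<close>, so the two lowest coefficients are the conjugates of the two highest.\<close>
  define c4 c3 c2 where "c4 = \<alpha> * \<kappa>^2"
    and "c3 = - 2 * \<alpha> * \<kappa> * u * v - of_real \<beta> * \<kappa> * cnj u * cnj v + \<gamma> * \<sigma> * \<kappa>"
    and "c2 = \<alpha> * (u * v)^2 + cnj \<alpha> * (cnj u * cnj v)^2
       + of_real \<beta> * (\<kappa> * cnj \<kappa> + u * v * cnj u * cnj v)
       - \<gamma> * \<sigma> * u * v - cnj \<gamma> * \<sigma> * cnj u * cnj v + of_real \<delta> * \<sigma>^2"
  have c3': "cnj c3 = - 2 * cnj \<alpha> * cnj \<kappa> * cnj u * cnj v - of_real \<beta> * cnj \<kappa> * u * v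
      + cnj \<gamma> * \<sigma> * cnj \<kappa>"
    by (simp add: c3_def cnj_\<sigma>)
  have c4': "cnj c4 = cnj \<alpha> * (cnj \<kappa>)^2" by (simp add: c4_def)
  have quartic: "c4 * s^4 + c3 * s^3 + c2 * s^2 + cnj c3 * s + cnj c4 = 0"
    if "hform \<alpha> \<beta> \<gamma> \<delta> S = 0" "s * cnj s = 1" "\<sigma> * S = \<kappa> * s - u * v" for s S
  proof -
    have "\<sigma> * cnj S = cnj \<kappa> * cnj s - cnj u * cnj v"
      using arg_cong[OF that(3), of cnj] by (simp add: cnj_\<sigma>)
    moreover have "\<sigma>^2 * s^2 * hform \<alpha> \<beta> \<gamma> \<delta> S = s^2 * (\<alpha> * (\<sigma> * S)^2 + cnj \<alpha> * (\<sigma> * cnj S)^2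
       + of_real \<beta> * (\<sigma> * S) * (\<sigma> * cnj S)
       + \<gamma> * \<sigma> * (\<sigma> * S) + cnj \<gamma> * \<sigma> * (\<sigma> * cnj S) + of_real \<delta> * \<sigma>^2)"
      unfolding hform_def by algebra
    ultimately have "\<sigma>^2 * s^2 * hform \<alpha> \<beta> \<gamma> \<delta> S = s^2 * (\<alpha> * (\<kappa> * s - u * v)^2
       + cnj \<alpha> * (cnj \<kappa> * cnj s - cnj u * cnj v)^2
       + of_real \<beta> * (\<kappa> * s - u * v) * (cnj \<kappa> * cnj s - cnj u * cnj v)
       + \<gamma> * \<sigma> * (\<kappa> * s - u * v) + cnj \<gamma> * \<sigma> * (cnj \<kappa> * cnj s - cnj u * cnj v) + of_real \<delta> * \<sigma>^2)"
      using that(3) by simp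
    also have "\<dots> = c4 * s^4 + c3 * s^3 + c2 * s^2 + cnj c3 * s + cnj c4"
      using that(2) unfolding c4' c3' unfolding c4_def c3_def c2_def by algebra
    finally show ?thesis using that(1) by simp
  qed
  have "c4 * s^4 + c3 * s^3 + c2 * s^2 + cnj c3 * s + cnj c4 = 0" if "s \<in> {1, r, z1, z2}" for s
    using that quartic[OF K(4) _ zp] quartic[OF K(5) r_unit zx] quartic[OF Z(1) z(1,4)]
      quartic[OF Z(2) z(2,5)] by auto
  from quartic_vieta[OF this dist4]
  have sum: "c3 = - c4 * (1 + r + z1 + z2)" and prod: "cnj c4 = c4 * (1 * r * z1 * z2)" by auto
  have "\<alpha> * \<kappa> * u * cnj \<kappa> * (\<kappa> * z1 * z2 - s3 * cnj \<kappa>) = 0"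
    using prod r xu \<alpha> unfolding c4' unfolding c4_def by algebra
  thus prd: "\<kappa> * z1 * z2 = s3 * cnj \<kappa>" using \<alpha>nz \<kappa>_nz nz by simp
  have "\<alpha> * \<kappa> * (\<kappa> * (1 + r + z1 + z2) - 2 * u * v - (s3 * cnj q + x * q) * cnj u * cnj v
     - (x + s1) * \<sigma>) = 0"
    using sum unfolding c3_def c4_def \<beta> \<gamma> by algebra
  hence "\<kappa> * (1 + r + z1 + z2) - 2 * u * v - (s3 * cnj q + x * q) * cnj u * cnj v
     - (x + s1) * \<sigma> = 0" using \<alpha>nz \<kappa>_nz by simp
  \<comment> \<open>The factor \<open>cnj u\<close> clears \<open>x\<close> and \<open>r\<close>,
    \<open>cnj w\<close> clears \<open>s3\<close>, and \<open>prd\<close> replaces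
    \<open>\<kappa> * z1 * z2\<close>; the root sum then becomes the chord equation for
    \<open>q\<close>.\<close>
  hence "\<kappa> * cnj u * cnj w * (q + z1 * z2 * cnj q - z1 - z2) = 0"
    using prd r xu s1_eq s3_w cnj_\<kappa>
    unfolding \<kappa>_def \<sigma>_def uvw_defs by algebra
  hence "q + z1 * z2 * cnj q - z1 - z2 = 0" using nz \<kappa>_nz by simp
  thus "q + z1 * z2 * cnj q = z1 + z2" by algebra
qed

text \<open>The left side is the \<open>z\<close>-derivative of the form at \<open>q\<close>, which
  carries the normal direction. Its factor \<open>\<kappa>\<close> is to be matched with the product
  \<open>\<kappa> * z1 * z2\<close> found from the quartic.\<close>

lemma conic_PQ_normal:
  assumes "hform \<alpha> \<beta> \<gamma> \<delta> a = 0" "hform \<alpha> \<beta> \<gamma> \<delta> b = 0" "hform \<alpha> \<beta> \<gamma> \<delta> c = 0"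
    "hform \<alpha> \<beta> \<gamma> \<delta> p = 0" and \<alpha>: "cnj \<alpha> = s3 * \<alpha>"
  shows "2 * \<alpha> * q + of_real \<beta> * cnj q + \<gamma> = - \<alpha> * \<kappa>"
proof -
  have "of_real \<beta> - \<alpha> * s3 * cnj q - cnj \<alpha> * cnj s3 * q = 0"
    using hform_isogonal[OF assms(1-3)] assms(4) P_off by simp
  hence \<beta>: "of_real \<beta> = \<alpha> * (s3 * cnj q + q)" using \<alpha> s3_unit by algebra
  have \<gamma>: "\<gamma> = - \<alpha> * (1 + s1)" using hform_circumscribed(1)[OF assms(1-3)] \<alpha> s3_unit by algebra
  have "cnj w * (2 * \<alpha> * q + of_real \<beta> * cnj q + \<gamma> + \<alpha> * \<kappa>) = 0"
    using s1_eq s3_w unfolding \<beta> \<gamma> \<kappa>_def \<sigma>_def uvw_defs by algebra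
  hence "2 * \<alpha> * q + of_real \<beta> * cnj q + \<gamma> + \<alpha> * \<kappa> = 0" using nz by simp
  thus ?thesis by algebra
qed

end

section \<open>Isogonal conjugacy in complex coordinates\<close>

text \<open>Chords satisfy \<open>cnj (b - a) = - (b - a) / (a * b)\<close>, so
  \<open>(b - a) * (c - a)\<close> factors out of the angle condition at \<open>a\<close>.\<close>

lemma unit_isogonal_line:
  fixes a b c p q :: complex
  assumes "a * cnj a = 1" "b * cnj b = 1" "c * cnj c = 1" "a \<noteq> b" "c \<noteq> a"
    and "(q - a) * (p - a) * cnj ((b - a) * (c - a)) = cnj ((q - a) * (p - a)) * ((b - a) * (c - a))"
  shows "p * q + a * b * c * (cnj p + cnj q) - (a * b + b * c + c * a)
    = a * (p + q + a * b * c * cnj p * cnj q - (a + b + c))"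
proof -
  have "(b - a) * (c - a) * (p * q + a * b * c * (cnj p + cnj q) - (a * b + b * c + c * a)
    - a * (p + q + a * b * c * cnj p * cnj q - (a + b + c))) = 0"
    using assms(1-3,6) unfolding complex_cnj_mult complex_cnj_diff by algebra
  thus ?thesis using assms(4,5) by simp
qed

text \<open>For unit vectors \<open>U\<close>, \<open>V\<close> along the sides, reflection in the
  bisector sends a vector to \<open>U * V\<close> times its conjugate. The conclusion says that the
  angles at \<open>A\<close> are equal.\<close>

lemma isogonal_lineD:
  fixes A B C P P' :: complex
  assumes "\<not> collinear {A, B, C}" "collinear {A, reflect_line A (bisector_dir A B C) P, P'}"
  shows "(P' - A) * (P - A) * cnj ((B - A) * (C - A)) = cnj ((P' - A) * (P - A)) * ((B - A) * (C - A))"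
proof -
  define m n where "m = complex_of_real (cmod (B - A))" and "n = complex_of_real (cmod (C - A))"
  define U V where "U = (B - A) / m" and "V = (C - A) / n"
  have "B \<noteq> A" "C \<noteq> A" using assms(1) by (auto simp: insert_commute)
  hence nz: "m \<noteq> 0" "n \<noteq> 0" by (auto simp: m_def n_def)
  have mn: "cnj m = m" "cnj n = n" by (simp_all add: m_def n_def)
  have "(B - A) * cnj (B - A) = m^2" "(C - A) * cnj (C - A) = n^2"
    unfolding m_def n_def complex_norm_square[symmetric] by simp_all
  hence UV: "U * cnj U = 1" "V * cnj V = 1"
    using nz mn by (simp_all add: U_def V_def power2_eq_square)
  have BC: "B - A = m * U" "C - A = n * V" using nz by (simp_all add: U_def V_def)
  have dir: "bisector_dir A B C = U + V" by (simp add: bisector_dir_def U_def V_def m_def n_def)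
  have "U + V \<noteq> 0"
  proof
    assume "U + V = 0"
    hence "V = - U" by algebra
    hence "collinear {A, B, C}" unfolding collinear_complex_iff BC by (simp add: mn)
    thus False using assms(1) by simp
  qed
  hence "cnj U + cnj V \<noteq> 0" by (metis complex_cnj_add complex_cnj_zero_iff)
  moreover have "U + V = U * V * (cnj U + cnj V)" using UV by algebra
  ultimately have "(U + V) / cnj (U + V) = U * V"
    by (metis complex_cnj_add nonzero_divide_eq_eq)
  hence "reflect_line A (bisector_dir A B C) P - A = U * V * cnj (P - A)"
    by (simp add: reflect_line_def dir)
  hence "U * V * cnj (P - A) * cnj (P' - A) = cnj (U * V * cnj (P - A)) * (P' - A)"
    using assms(2) by (simp only: collinear_complex_iff)
  hence "U * V * cnj (P - A) * cnj (P' - A) = cnj U * cnj V * (P - A) * (P' - A)" by simp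
  thus ?thesis unfolding BC complex_cnj_mult mn by algebra
qed

section \<open>From real conic coefficients to complex forms\<close>

definition conic_eval :: "conic \<Rightarrow> complex \<Rightarrow> real" where
  "conic_eval K z = (case K of (a,b,c,d,e,f) \<Rightarrow>
     a * (Re z)^2 + b * Re z * Im z + c * (Im z)^2 + d * Re z + e * Im z + f)"

lemma on_conic_iff: "on_conic K z \<longleftrightarrow> conic_eval K z = 0"
  by (simp add: on_conic_def conic_eval_def split: prod.splits)

lemma hform_affine:
  "hform \<alpha> \<beta> \<gamma> \<delta> (o' + \<rho> * z) = hform (\<alpha> * \<rho>^2) (\<beta> * (cmod \<rho>)^2)
     (\<rho> * (\<gamma> + 2 * \<alpha> * o' + of_real \<beta> * cnj o')) (Re (hform \<alpha> \<beta> \<gamma> \<delta> o')) z"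
proof -
  have "Im (hform \<alpha> \<beta> \<gamma> \<delta> o') = 0" by (simp add: hform_def power2_eq_square)
  hence \<delta>: "of_real (Re (hform \<alpha> \<beta> \<gamma> \<delta> o')) = hform \<alpha> \<beta> \<gamma> \<delta> o'" by (simp add: complex_eq_iff)
  have \<rho>: "of_real (\<beta> * (cmod \<rho>)^2) = of_real \<beta> * (\<rho> * cnj \<rho>)"
    by (simp only: of_real_mult complex_norm_square)
  show ?thesis
    unfolding hform_def[of _ "\<beta> * _"] \<rho> \<delta>
    unfolding hform_def complex_cnj_add complex_cnj_mult complex_cnj_power complex_cnj_complex_of_real
      complex_cnj_cnj complex_cnj_numeral by algebra
qed

text \<open>The conjugate of the gradient is twice the \<open>z\<close>-derivative; the factor
  \<open>\<rho>\<close> in the second clause is the chain rule.\<close>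

lemma conic_hform:
  obtains \<alpha> \<beta> \<gamma> \<delta> where
    "\<And>z. complex_of_real (conic_eval K (o' + \<rho> * z)) = hform \<alpha> \<beta> \<gamma> \<delta> z"
    "\<And>z. cnj (conic_grad K (o' + \<rho> * z)) * \<rho> = 2 * (2 * \<alpha> * z + of_real \<beta> * cnj z + \<gamma>)"
    "is_conic K \<Longrightarrow> \<rho> \<noteq> 0 \<Longrightarrow> \<alpha> \<noteq> 0 \<or> \<beta> \<noteq> 0"
    "is_circle K \<Longrightarrow> \<rho> \<noteq> 0 \<Longrightarrow> \<alpha> = 0 \<and> \<beta> \<noteq> 0"
proof -
  obtain a b c d e f where K: "K = (a, b, c, d, e, f)" by (cases K) auto
  define \<alpha> \<beta> \<gamma> where "\<alpha> = Complex ((a - c) / 4) (- b / 4)" and "\<beta> = (a + c) / 2"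
    and "\<gamma> = Complex (d / 2) (- e / 2)"
  have ev: "complex_of_real (conic_eval K z) = hform \<alpha> \<beta> \<gamma> f z" for z
    by (simp add: K conic_eval_def hform_def \<alpha>_def \<beta>_def \<gamma>_def complex_eq_iff power2_eq_square
        field_simps)
  have gr: "cnj (conic_grad K z) = 2 * (2 * \<alpha> * z + of_real \<beta> * cnj z + \<gamma>)" for z
    by (simp add: K conic_grad_def \<alpha>_def \<beta>_def \<gamma>_def complex_eq_iff field_simps)
  have \<rho>: "of_real (\<beta> * (cmod \<rho>)^2) = of_real \<beta> * (\<rho> * cnj \<rho>)"
    by (simp only: of_real_mult complex_norm_square)
  show thesis
  proof (rule that)
    show "complex_of_real (conic_eval K (o' + \<rho> * z)) = hform (\<alpha> * \<rho>^2) (\<beta> * (cmod \<rho>)^2)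
     (\<rho> * (\<gamma> + 2 * \<alpha> * o' + of_real \<beta> * cnj o')) (Re (hform \<alpha> \<beta> \<gamma> f o')) z" for z
      unfolding ev by (rule hform_affine)
    show "cnj (conic_grad K (o' + \<rho> * z)) * \<rho> = 2 * (2 * (\<alpha> * \<rho>^2) * z
        + of_real (\<beta> * (cmod \<rho>)^2) * cnj z + \<rho> * (\<gamma> + 2 * \<alpha> * o' + of_real \<beta> * cnj o'))" for z
      unfolding gr \<rho> complex_cnj_add complex_cnj_mult by algebra
    show "\<alpha> * \<rho>^2 \<noteq> 0 \<or> \<beta> * (cmod \<rho>)^2 \<noteq> 0" if "is_conic K" "\<rho> \<noteq> 0"
    proof -
      have "\<alpha> \<noteq> 0 \<or> \<beta> \<noteq> 0"
        using that(1) by (auto simp: K is_conic_def \<alpha>_def \<beta>_def complex_eq_iff)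
      thus ?thesis using that(2) by auto
    qed
    show "\<alpha> * \<rho>^2 = 0 \<and> \<beta> * (cmod \<rho>)^2 \<noteq> 0" if "is_circle K" "\<rho> \<noteq> 0"
      using that by (auto simp: zero_complex.code K is_circle_def \<alpha>_def \<beta>_def complex_eq_iff)
  qed
qed

lemma circle_center:
  assumes "is_circle K"
  obtains o' R where "R > 0" "\<And>z. on_conic K z \<longleftrightarrow> (z - o') * cnj (z - o') = complex_of_real R"
proof -
  obtain a b c d e f where K: "K = (a, b, c, d, e, f)" by (cases K) auto
  have a: "a \<noteq> 0" "c = a" "b = 0" "d^2 + e^2 > 4 * a * f" using assms by (auto simp: K is_circle_def)
  \<comment> \<open>Completing the square; \<open>R\<close> is the squared radius.\<close>
  define o' R where "o' = Complex (- d / (2 * a)) (- e / (2 * a))"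
    and "R = (d^2 + e^2 - 4 * a * f) / (2 * a)^2"
  have "R > 0" using a by (simp add: R_def)
  moreover have "on_conic K z \<longleftrightarrow> (z - o') * cnj (z - o') = complex_of_real R" for z
  proof -
    have "(z - o') * cnj (z - o') = complex_of_real R
      \<longleftrightarrow> (Re z + d / (2 * a))^2 + (Im z + e / (2 * a))^2 = R"
      unfolding complex_mult_cnj of_real_eq_iff by (simp add: o'_def)
    also have "\<dots> \<longleftrightarrow> conic_eval K z / a = 0"
    proof -
      have "(Re z + d / (2 * a))^2 + (Im z + e / (2 * a))^2 - R = conic_eval K z / a"
        using a(1) by (simp add: K conic_eval_def a R_def power2_eq_square field_simps)
      thus ?thesis by linarith
    qed
    also have "\<dots> \<longleftrightarrow> on_conic K z" using a(1) by (simp add: on_conic_iff)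
    finally show ?thesis by simp
  qed
  ultimately show thesis using that by blast
qed

lemma collinear_affine:
  fixes \<rho> :: complex
  assumes "\<rho> \<noteq> 0"
  shows "collinear {o' + \<rho> * u, o' + \<rho> * v, o' + \<rho> * w} \<longleftrightarrow> collinear {u, v, w}"
proof -
  have "(o' + \<rho> * v - (o' + \<rho> * u)) * cnj (o' + \<rho> * w - (o' + \<rho> * u))
       = \<rho> * cnj \<rho> * ((v - u) * cnj (w - u))"
    "cnj (o' + \<rho> * v - (o' + \<rho> * u)) * (o' + \<rho> * w - (o' + \<rho> * u))
       = \<rho> * cnj \<rho> * (cnj (v - u) * (w - u))"
    by (simp_all add: algebra_simps)
  thus ?thesis unfolding collinear_complex_iff using assms by simp
qed

text \<open>The squared line has zero value and zero gradient on the line itself. The quadratic part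
  survives because a nonzero rank-one form is never a multiple of that of a circle.\<close>

lemma double_contact_pencil:
  fixes W P :: complex and s :: real
  assumes "is_circle \<Gamma>" "W \<noteq> 0"
  obtains K where "is_conic K"
    "\<And>z. conic_eval K z = s * conic_eval \<Gamma> z + (Im (cnj W * (z - P)))^2"
    "\<And>z. Im (cnj W * (z - P)) = 0 \<Longrightarrow> conic_grad K z = of_real s * conic_grad \<Gamma> z"
proof -
  obtain a b c d e f where \<Gamma>: "\<Gamma> = (a, b, c, d, e, f)" by (cases \<Gamma>) auto
  have a: "c = a" "b = 0" using assms by (auto simp: \<Gamma> is_circle_def)
  define l m n where "l = - Im W" and "m = Re W" and "n = - Im (cnj W * P)"
  have L: "Im (cnj W * (z - P)) = l * Re z + m * Im z + n" for z
    by (simp add: l_def m_def n_def algebra_simps)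
  show thesis
  proof (rule that)
    let ?K = "(s * a + l^2, s * b + 2 * l * m, s * c + m^2, s * d + 2 * l * n,
      s * e + 2 * m * n, s * f + n^2)"
    show "is_conic ?K"
    proof -
      have False if "s * a + l^2 = 0" "2 * l * m = 0" "s * a + m^2 = 0"
      proof -
        have "l^2 = m^2" "l * m = 0" using that by auto
        hence "l = 0" "m = 0" by auto
        thus False using assms(2) by (simp add: l_def m_def complex_eq_iff)
      qed
      thus ?thesis by (auto simp: is_conic_def a)
    qed
    show "conic_eval ?K z = s * conic_eval \<Gamma> z + (Im (cnj W * (z - P)))^2" for z
      unfolding L by (simp add: conic_eval_def \<Gamma> power2_eq_square algebra_simps)
    show "conic_grad ?K z = of_real s * conic_grad \<Gamma> z" if "Im (cnj W * (z - P)) = 0" for z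
    proof -
      have n: "n = - l * Re z - m * Im z" using that unfolding L by simp
      show ?thesis unfolding n
        by (simp add: conic_grad_def \<Gamma> complex_eq_iff power2_eq_square algebra_simps)
    qed
  qed
qed

lemma conic_grad_scale: "conic_grad (conic_scale t K) z = of_real t * conic_grad K z"
  by (simp add: conic_grad_def conic_scale_def complex_eq_iff algebra_simps split: prod.splits)

section \<open>Normalisation and the two tangency claims\<close>

theorem theorem1p2:
  fixes A B C P P' D X Y Z :: complex and \<Omega> Q \<Gamma> :: conic
  assumes tri: "\<not> collinear {A, B, C}"
    and Om: "is_circle \<Omega>" "on_conic \<Omega> A" "on_conic \<Omega> B" "on_conic \<Omega> C"
    and Pgen: "\<not> collinear {A, B, P}" "\<not> collinear {B, C, P}" "\<not> collinear {C, A, P}"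
              "\<not> on_conic \<Omega> P"
    and iso: "isogonal_conj A B C P P'" and PP': "P \<noteq> P'"
    and Qc: "unique_conic5 A B C P P'" "is_conic Q"
            "on_conic Q A" "on_conic Q B" "on_conic Q C" "on_conic Q P" "on_conic Q P'"
    and Dd: "on_conic \<Omega> D" "on_conic Q D" "D \<notin> {A, B, C}"
    and Xd: "on_conic \<Omega> X" "collinear {D, P, X}" "X \<noteq> D"
    and Yd: "on_conic \<Omega> Y" "collinear {D, P', Y}" "Y \<noteq> D"
    and Gc: "\<not> collinear {P, X, Y}" "is_circle \<Gamma>"
            "on_conic \<Gamma> P" "on_conic \<Gamma> X" "on_conic \<Gamma> Y"
    and Zd: "on_conic \<Gamma> Z" "collinear {P, P', Z}" "Z \<noteq> P"
  shows
    "(unique_conic5 A B C P Z \<longrightarrow>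
       (\<forall>K. is_conic K \<and> on_conic K A \<and> on_conic K B \<and> on_conic K C \<and> on_conic K P \<and> on_conic K Z
            \<longrightarrow> curves_tangent_at \<Gamma> K P \<and> curves_tangent_at \<Gamma> K Z))
     \<and>
     (\<forall>K Z1 Z2 Z1' Z2'.
        unique_conic5 A B C P X \<and> is_conic K \<and>
        on_conic K A \<and> on_conic K B \<and> on_conic K C \<and> on_conic K P \<and> on_conic K X \<and>
        on_conic \<Gamma> Z1 \<and> on_conic K Z1 \<and> on_conic \<Gamma> Z2 \<and> on_conic K Z2 \<and>
        Z1 \<noteq> Z2 \<and> Z1 \<notin> {P, X} \<and> Z2 \<notin> {P, X} \<and>
        on_conic \<Omega> Z1' \<and> collinear {X, Z1, Z1'} \<and> Z1' \<noteq> X \<and>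
        on_conic \<Omega> Z2' \<and> collinear {X, Z2, Z2'} \<and> Z2' \<noteq> X \<and>
        Z1' \<noteq> Z2'
        \<longrightarrow> line_tangent_at Z1' Z2' Q P')"
proof -
  obtain o' R where R: "R > 0" and \<Omega>: "\<And>z. on_conic \<Omega> z \<longleftrightarrow> (z - o') * cnj (z - o') = complex_of_real R"
    using circle_center[OF Om(1)] by metis
  \<comment> \<open>The map taking \<open>z\<close> to \<open>o' + \<rho> * z\<close> sends the unit
    circle to \<Omega> and \<open>1\<close> to \<open>D\<close>.\<close>
  define \<rho> where "\<rho> = D - o'"
  have \<rho>R: "\<rho> * cnj \<rho> = of_real R" using Dd(1) unfolding \<Omega> \<rho>_def .
  hence \<rho>: "\<rho> \<noteq> 0" using R by auto
  have on\<Omega>: "on_conic \<Omega> (o' + \<rho> * z) \<longleftrightarrow> z * cnj z = 1" for z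
  proof -
    have "(o' + \<rho> * z - o') * cnj (o' + \<rho> * z - o') = of_real R * (z * cnj z)"
      unfolding \<rho>R[symmetric] by simp
    thus ?thesis unfolding \<Omega> using R by (simp only:) simp
  qed
  have ex: "\<exists>z. V = o' + \<rho> * z" for V using \<rho> by (intro exI[of _ "(V - o') / \<rho>"]) simp
  obtain a b c p q x y z where pts: "A = o' + \<rho> * a" "B = o' + \<rho> * b" "C = o' + \<rho> * c"
    "P = o' + \<rho> * p" "P' = o' + \<rho> * q" "X = o' + \<rho> * x" "Y = o' + \<rho> * y" "Z = o' + \<rho> * z"
    using ex by metis
  have D: "D = o' + \<rho> * 1" by (simp add: \<rho>_def)
  note col = collinear_affine[OF \<rho>, of o']
  note [simp] = \<rho>
  have abc: "\<not> collinear {a, b, c}" using tri unfolding pts col .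
  hence dist: "a \<noteq> b" "b \<noteq> c" "c \<noteq> a" by (auto simp: insert_commute)
  have units: "a * cnj a = 1" "b * cnj b = 1" "c * cnj c = 1" "x * cnj x = 1" "y * cnj y = 1"
    using Om(2-4) Xd(1) Yd(1) unfolding pts on\<Omega> by auto
  have p_off: "p * cnj p \<noteq> 1" using Pgen(4) unfolding pts on\<Omega> .
  have pgen: "\<not> collinear {a, b, p}" "\<not> collinear {b, c, p}" "\<not> collinear {c, a, p}"
    using Pgen(1-3) unfolding pts col by auto
  have pq: "p \<noteq> q" using PP' by (auto simp: pts)
  have line: "(q - t) * (p - t) * cnj ((r - t) * (s - t)) = cnj ((q - t) * (p - t)) * ((r - t) * (s - t))"
    if "\<not> collinear {t, r, s}"
       "collinear {o' + \<rho> * t, reflect_line (o' + \<rho> * t) (bisector_dir (o' + \<rho> * t) (o' + \<rho> * r) (o' + \<rho> * s)) P, P'}"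
    for t r s
  proof -
    have nc: "\<not> collinear {o' + \<rho> * t, o' + \<rho> * r, o' + \<rho> * s}" using that(1) unfolding col .
    have "(\<rho> * cnj \<rho>)^2 * ((q - t) * (p - t) * cnj ((r - t) * (s - t)))
        = (\<rho> * cnj \<rho>)^2 * (cnj ((q - t) * (p - t)) * ((r - t) * (s - t)))"
      using isogonal_lineD[OF nc that(2)]
      unfolding pts complex_cnj_mult complex_cnj_diff complex_cnj_add by algebra
    thus ?thesis by simp
  qed
  \<comment> \<open>\<open>unit_isogonal_line\<close> will give \<open>M = a * N = b * N\<close>,
    and \<open>N = 0\<close> is the isogonal relation of the locale.\<close>
  define M where "M = p * q + a * b * c * (cnj p + cnj q) - (a * b + b * c + c * a)"
  define N where "N = p + q + a * b * c * cnj p * cnj q - (a + b + c)"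
  have "\<not> collinear {b, c, a}" using abc by (simp add: insert_commute)
  hence "(q - a) * (p - a) * cnj ((b - a) * (c - a)) = cnj ((q - a) * (p - a)) * ((b - a) * (c - a))"
    "(q - b) * (p - b) * cnj ((c - b) * (a - b)) = cnj ((q - b) * (p - b)) * ((c - b) * (a - b))"
    using line[OF abc] line[of b c a] iso unfolding isogonal_conj_def pts by auto
  hence "M = a * N" "M = b * N"
    using unit_isogonal_line[of a b c q p] unit_isogonal_line[of b c a q p] units dist
    unfolding M_def N_def by (auto simp: algebra_simps)
  hence "(a - b) * N = 0" by algebra
  hence "N = 0" using dist by simp
  then interpret unit_isogonal a b c p q
    using units dist p_off by unfold_locales (auto simp: N_def)
  have q_off: "q * cnj q \<noteq> 1" using Q_off_circle[OF pgen] .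

  obtain \<alpha> \<beta> \<gamma> \<delta> where
    Qe: "\<And>z. complex_of_real (conic_eval Q (o' + \<rho> * z)) = hform \<alpha> \<beta> \<gamma> \<delta> z" and
    Qg: "\<And>z. cnj (conic_grad Q (o' + \<rho> * z)) * \<rho> = 2 * (2 * \<alpha> * z + of_real \<beta> * cnj z + \<gamma>)" and
    Qnz: "\<alpha> \<noteq> 0 \<or> \<beta> \<noteq> 0"
    using conic_hform[of Q o' \<rho>] Qc(2) \<rho> by metis
  have onQ: "on_conic Q (o' + \<rho> * z) \<longleftrightarrow> hform \<alpha> \<beta> \<gamma> \<delta> z = 0" for z
    unfolding on_conic_iff Qe[symmetric] by simp
  have Qpts: "hform \<alpha> \<beta> \<gamma> \<delta> a = 0" "hform \<alpha> \<beta> \<gamma> \<delta> b = 0" "hform \<alpha> \<beta> \<gamma> \<delta> c = 0"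
    "hform \<alpha> \<beta> \<gamma> \<delta> p = 0" "hform \<alpha> \<beta> \<gamma> \<delta> q = 0" "hform \<alpha> \<beta> \<gamma> \<delta> 1 = 0"
    using Qc(3-7) Dd(2) unfolding pts D onQ by auto
  have "1 \<noteq> a" "1 \<noteq> b" "1 \<noteq> c" using Dd(3) unfolding pts D by auto
  hence \<alpha>: "cnj \<alpha> = s3 * \<alpha>" using fourth_intersection[OF Qpts(1-3,6)] by simp
  have s3pq: "s3 * (cnj p - cnj q) = - (p - q)"
    using fourth_intersection_direction[OF Qpts(1-5) Qnz q_off \<alpha>] .
  have xy1: "x \<noteq> 1" "y \<noteq> 1" using Xd(3) Yd(3) unfolding pts D by auto
  have "p + x * cnj p = 1 + x" "q + y * cnj q = 1 + y"
    using unit_chord[of 1 x p] unit_chord[of 1 y q] units xy1 Xd(2) Yd(2) unfolding pts D col by auto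
  moreover have "x \<noteq> y" using Gc(1) unfolding pts by auto
  ultimately interpret normalized_configuration a b c p q x y
    using pq q_off s3pq units xy1 by unfold_locales auto

  obtain \<alpha>' g \<gamma>' \<delta>' where "\<And>z. complex_of_real (conic_eval \<Gamma> (o' + \<rho> * z)) = hform \<alpha>' g \<gamma>' \<delta>' z"
    "\<alpha>' = 0" and g: "g \<noteq> 0"
    using conic_hform[of \<Gamma> o' \<rho>] Gc(2) \<rho> by metis
  hence \<Gamma>e: "\<And>z. complex_of_real (conic_eval \<Gamma> (o' + \<rho> * z)) = hform 0 g \<gamma>' \<delta>' z" by simp
  have on\<Gamma>: "on_conic \<Gamma> (o' + \<rho> * z) \<longleftrightarrow> hform 0 g \<gamma>' \<delta>' z = 0" for z
    unfolding on_conic_iff \<Gamma>e[symmetric] by simp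
  have \<Gamma>pts: "hform 0 g \<gamma>' \<delta>' x = 0" "hform 0 g \<gamma>' \<delta>' y = 0" "hform 0 g \<gamma>' \<delta>' p = 0"
    using Gc(3-5) unfolding pts on\<Gamma> by auto

  show ?thesis
  proof (intro conjI impI allI)
    fix K
    assume uniq: "unique_conic5 A B C P Z"
      and K: "is_conic K \<and> on_conic K A \<and> on_conic K B \<and> on_conic K C \<and> on_conic K P \<and> on_conic K Z"
    define L where "L T = Im (cnj (P - P') * (T - P))" for T
    \<comment> \<open>Chosen to cancel \<open>double_contact\<close> at the vertices: rescaling
      multiplies the line equation by \<open>R\<close>, and the bracket there is twice the imaginary
      unit times a real number, whence the 4.\<close>
    define s where "s = - (R^2 * Re \<sigma> * (cmod w)^2 / (4 * g))"
    have LT: "s * conic_eval \<Gamma> (o' + \<rho> * t) + (L (o' + \<rho> * t))^2 = 0"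
      if t: "t * cnj t = 1" "(t - a) * (t - b) * (t - c) = 0" for t
    proof -
      define i where "i = Im (cnj w * (t - p))"
      have "cnj (P - P') * (o' + \<rho> * t - P) = of_real R * (cnj w * (t - p))"
        unfolding \<rho>R[symmetric] by (simp add: pts w_def algebra_simps)
      hence L: "L (o' + \<rho> * t) = R * i" by (simp add: L_def i_def)
      have "cnj w * (t - p) - w * (cnj t - cnj p) = 2 * \<i> * of_real i"
        by (simp add: i_def complex_eq_iff algebra_simps)
      moreover have "\<sigma> = of_real (Re \<sigma>)" by (simp add: \<sigma>_def complex_eq_iff)
      moreover have "w * cnj w = of_real ((cmod w)^2)" by (simp only: complex_norm_square)
      ultimately have "of_real (Re \<sigma> * (cmod w)^2 * conic_eval \<Gamma> (o' + \<rho> * t)) = complex_of_real (4 * g * i^2)"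
        using double_contact[OF \<Gamma>pts t] unfolding \<Gamma>e[symmetric]
        by (simp add: power_mult_distrib mult.assoc)
      hence "Re \<sigma> * (cmod w)^2 * conic_eval \<Gamma> (o' + \<rho> * t) = 4 * g * i^2"
        by (simp only: of_real_eq_iff)
      thus ?thesis unfolding L s_def using g by (simp add: field_simps)
    qed
    obtain K0 where K0: "is_conic K0" "\<And>z. conic_eval K0 z = s * conic_eval \<Gamma> z + (L z)^2"
      "\<And>z. L z = 0 \<Longrightarrow> conic_grad K0 z = of_real s * conic_grad \<Gamma> z"
      using double_contact_pencil[OF Gc(2), of "P - P'" s P] PP' unfolding L_def
      by (metis eq_iff_diff_eq_0)
    have LP: "L P = 0" by (simp add: L_def)
    have "(P' - P) * cnj (Z - P) = cnj (P' - P) * (Z - P)"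
      using Zd(2) unfolding collinear_complex_iff .
    hence LZ: "L Z = 0" by (simp add: L_def complex_eq_iff algebra_simps)
    have "on_conic K0 A" "on_conic K0 B" "on_conic K0 C"
      unfolding on_conic_iff K0(2) pts using LT units by auto
    moreover have "on_conic K0 P" "on_conic K0 Z"
      unfolding on_conic_iff K0(2) using LP LZ Gc(3) Zd(1) by (auto simp: on_conic_iff)
    \<comment> \<open>Uniqueness makes \<open>K\<close> a multiple of the double-contact conic
      \<open>K0\<close>, so its gradient is parallel to that of \<open>\<Gamma>\<close> wherever
      \<open>L\<close> vanishes.\<close>
    ultimately obtain t where "K = conic_scale t K0"
      using uniq K K0(1) unfolding unique_conic5_def by blast
    hence "conic_grad K T = of_real (t * s) * conic_grad \<Gamma> T" if "L T = 0" for T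
      using K0(3)[OF that] by (simp add: conic_grad_scale)
    thus "curves_tangent_at \<Gamma> K P" "curves_tangent_at \<Gamma> K Z"
      using LP LZ K Gc(3) Zd(1) by (auto simp: curves_tangent_at_def)
  next
    fix K Z1 Z2 Z1' Z2'
    assume H: "unique_conic5 A B C P X \<and> is_conic K \<and>
        on_conic K A \<and> on_conic K B \<and> on_conic K C \<and> on_conic K P \<and> on_conic K X \<and>
        on_conic \<Gamma> Z1 \<and> on_conic K Z1 \<and> on_conic \<Gamma> Z2 \<and> on_conic K Z2 \<and>
        Z1 \<noteq> Z2 \<and> Z1 \<notin> {P, X} \<and> Z2 \<notin> {P, X} \<and>
        on_conic \<Omega> Z1' \<and> collinear {X, Z1, Z1'} \<and> Z1' \<noteq> X \<and>
        on_conic \<Omega> Z2' \<and> collinear {X, Z2, Z2'} \<and> Z2' \<noteq> X \<and>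
        Z1' \<noteq> Z2'"
    obtain \<zeta>1 \<zeta>2 z1 z2 where pts': "Z1 = o' + \<rho> * \<zeta>1" "Z2 = o' + \<rho> * \<zeta>2"
      "Z1' = o' + \<rho> * z1" "Z2' = o' + \<rho> * z2"
      using ex by metis
    obtain \<alpha>2 \<beta>2 \<gamma>2 \<delta>2 where
      Ke: "\<And>z. complex_of_real (conic_eval K (o' + \<rho> * z)) = hform \<alpha>2 \<beta>2 \<gamma>2 \<delta>2 z" and
      Knz: "\<alpha>2 \<noteq> 0 \<or> \<beta>2 \<noteq> 0"
      using conic_hform[of K o' \<rho>] H \<rho> by metis
    have onK: "on_conic K (o' + \<rho> * z) \<longleftrightarrow> hform \<alpha>2 \<beta>2 \<gamma>2 \<delta>2 z = 0" for z
      unfolding on_conic_iff Ke[symmetric] by simp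
    have K: "hform \<alpha>2 \<beta>2 \<gamma>2 \<delta>2 a = 0" "hform \<alpha>2 \<beta>2 \<gamma>2 \<delta>2 b = 0" "hform \<alpha>2 \<beta>2 \<gamma>2 \<delta>2 c = 0"
      "hform \<alpha>2 \<beta>2 \<gamma>2 \<delta>2 p = 0" "hform \<alpha>2 \<beta>2 \<gamma>2 \<delta>2 x = 0"
      "hform \<alpha>2 \<beta>2 \<gamma>2 \<delta>2 \<zeta>1 = 0" "hform \<alpha>2 \<beta>2 \<gamma>2 \<delta>2 \<zeta>2 = 0"
      using H unfolding pts pts' onK by auto
    have \<zeta>: "\<zeta>1 \<noteq> p" "\<zeta>1 \<noteq> x" "\<zeta>2 \<noteq> p" "\<zeta>2 \<noteq> x" using H unfolding pts pts' by auto
    have z12: "z1 * cnj z1 = 1" "z2 * cnj z2 = 1" using H unfolding pts' on\<Omega> by auto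
    have ne: "z1 \<noteq> z2" "z1 \<noteq> x" "z2 \<noteq> x" using H unfolding pts pts' by auto
    have zc: "collinear {x, \<zeta>1, z1}" "collinear {x, \<zeta>2, z2}" using H unfolding pts pts' col by auto
    have z\<Gamma>: "hform 0 g \<gamma>' \<delta>' \<zeta>1 = 0" "hform 0 g \<gamma>' \<delta>' \<zeta>2 = 0"
      using H unfolding pts' on\<Gamma> by auto
    note chord = chord_from_quartic[OF K(1-5) Knz K(6,7) \<zeta> z12 ne(1)
      second_point_on_circle_PXY[OF \<Gamma>pts g z\<Gamma>(1) \<zeta>(2) z12(1) ne(2) zc(1)]
      second_point_on_circle_PXY[OF \<Gamma>pts g z\<Gamma>(2) \<zeta>(4) z12(2) ne(3) zc(2)]]
    define n where "n = cnj (conic_grad Q P') * (Z2' - Z1')"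
    have "n = cnj (conic_grad Q P') * \<rho> * (z2 - z1)"
      by (simp add: n_def pts' algebra_simps)
    also have "\<dots> = 2 * (2 * \<alpha> * q + of_real \<beta> * cnj q + \<gamma>) * (z2 - z1)" unfolding pts Qg ..
    also have "\<dots> = - 2 * \<alpha> * \<kappa> * (z2 - z1)"
      unfolding conic_PQ_normal[OF Qpts(1-4) \<alpha>] by simp
    finally have n: "n = - 2 * \<alpha> * \<kappa> * (z2 - z1)" .
    have "cnj n = - 2 * cnj \<alpha> * cnj \<kappa> * (cnj z2 - cnj z1)" by (simp add: n)
    \<comment> \<open>Here \<open>z1 * z2 * (cnj z2 - cnj z1) = - (z2 - z1)\<close> and
      \<open>cnj \<alpha> * cnj \<kappa> = \<alpha> * \<kappa> * z1 * z2\<close>, so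
      \<open>cnj n = - n\<close>.\<close>
    hence "z1 * z2 * (n + cnj n) = 0" using n \<alpha> chord(1) z12 by algebra
    hence "n + cnj n = 0" using z12 by auto
    hence "Re n = 0" by (simp add: complex_eq_iff)
    moreover have "collinear {Z1', Z2', P'}"
      using collinear_chord[OF z12 chord(2)] unfolding pts pts' col .
    ultimately show "line_tangent_at Z1' Z2' Q P'"
      using H Qc(7) unfolding line_tangent_at_def n_def by simp
  qed
qed

end
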